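(* For each $t\in[0,1)$ both of the bounded operators $C_t\colon H^\infty\to H^\infty$ and $C_t\colon A(\mathbb{D})\to A(\mathbb{D})$ are power bounded and uniformly mean ergodic, but fail to be supercyclic.
   Context: Let $\mathbb{D}=\{z\in\mathbb{C}:|z|<1\}$ and let $H(\mathbb{D})$ be the space of holomorphic functions on $\mathbb{D}$. $H^\infty$ is the Banach space of bounded $f\in H(\mathbb{D})$ with the norm $\|f\|_\infty=\sup_{z\in\mathbb{D}}|f(z)|$. The disc algebra $A(\mathbb{D})$ is its closed subspace of all $f\in H(\mathbb{D})$ that extend to a continuous function on $\overline{\mathbb{D}}$. For $t\in[0,1)$ the generalized Cesàro operator $C_t\colon H(\mathbb{D})\to H(\mathbb{D})$ is defined by $(C_tf)(0):=f(0)$ and $(C_tf)(z):=\frac1z\int_0^z\frac{f(\xi)}{1-t\xi}\,d\xi$ for $z\in\mathbb{D}\setminus\{0\}$; it acts continuously on $H^\infty$ and on $A(\mathbb{D})$. A bounded linear operator $T$ on a complex Banach space $X$ is power bounded if $\sup_{n\in\mathbb{N}_0}\|T^n\|_{X\to X}<\infty$ (where $\mathbb{N}_0=\{0,1,2,\ldots\}$); uniformly mean ergodic if the Cesàro means $T_{[n]}:=\frac1n\sum_{m=1}^nT^m$, $n\in\mathbb{N}$, converge in the operator norm; and supercyclic if for some $x\in X$ the projective orbit $\{\lambda T^nx:\lambda\in\mathbb{C},\ n\in\mathbb{N}_0\}$ is dense in $X$. *)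

theory Defs
  imports "HOL-Complex_Analysis.Complex_Analysis"
begin

section \<open>Complex Banach spaces and dynamics of bounded operators\<close>

class complex_banach = banach +
  fixes scaleC :: "complex \<Rightarrow> 'a \<Rightarrow> 'a" (infixr "*\<^sub>C" 75)
  assumes scaleC_add_right: "c *\<^sub>C (x + y) = c *\<^sub>C x + c *\<^sub>C y"
    and scaleC_add_left: "(c + d) *\<^sub>C x = c *\<^sub>C x + d *\<^sub>C x"
    and scaleC_scaleC: "c *\<^sub>C (d *\<^sub>C x) = (c * d) *\<^sub>C x"
    and scaleC_of_real: "complex_of_real r *\<^sub>C x = r *\<^sub>R x"
    and norm_scaleC: "norm (c *\<^sub>C x) = cmod c * norm x"

text \<open>
  Operators are elements of the library type \<open>'a \<Rightarrow>\<^sub>L 'a\<close> of bounded \<open>\<real>\<close>-linear operators, whose norm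
  is the operator norm.  For a \<open>\<complex>\<close>-linear operator this is the same norm as in the complex setting,
  and a norm limit of \<open>\<complex>\<close>-linear operators is \<open>\<complex>\<close>-linear.  The operators studied below are
  \<open>\<complex>\<close>-linear (lemmas \<open>Cesaro_hinf_scaleC\<close> and \<open>Cesaro_disc_scaleC\<close>).
\<close>

primrec blinfun_power :: "('a::real_normed_vector \<Rightarrow>\<^sub>L 'a) \<Rightarrow> nat \<Rightarrow> ('a \<Rightarrow>\<^sub>L 'a)" where
  "blinfun_power T 0 = id_blinfun"
| "blinfun_power T (Suc n) = T o\<^sub>L blinfun_power T n"

definition power_bounded :: "('a::complex_banach \<Rightarrow>\<^sub>L 'a) \<Rightarrow> bool" where
  "power_bounded T \<longleftrightarrow> bdd_above (range (\<lambda>n. norm (blinfun_power T n)))"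

definition cesaro_mean :: "('a::real_normed_vector \<Rightarrow>\<^sub>L 'a) \<Rightarrow> nat \<Rightarrow> ('a \<Rightarrow>\<^sub>L 'a)" where
  "cesaro_mean T n = (1 / real n) *\<^sub>R (\<Sum>m = 1..n. blinfun_power T m)"

definition uniformly_mean_ergodic :: "('a::complex_banach \<Rightarrow>\<^sub>L 'a) \<Rightarrow> bool" where
  "uniformly_mean_ergodic T \<longleftrightarrow> convergent (cesaro_mean T)"

definition supercyclic :: "('a::complex_banach \<Rightarrow>\<^sub>L 'a) \<Rightarrow> bool" where
  "supercyclic T \<longleftrightarrow>
     (\<exists>x. closure {c *\<^sub>C blinfun_apply (blinfun_power T n) x | c n. True} = UNIV)"


section \<open>The space of bounded holomorphic functions on the unit disc\<close>

abbreviation unit_disc :: "complex set" where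
  "unit_disc \<equiv> ball 0 1"

text \<open>
  A function on the disc is represented by its extension by zero to \<open>\<complex>\<close>, so that equality in the
  type is equality on the disc.
\<close>

typedef hinf = "{f :: complex \<Rightarrow> complex. f holomorphic_on unit_disc \<and> bounded (f ` unit_disc) \<and>
                   (\<forall>z. z \<notin> unit_disc \<longrightarrow> f z = 0)}"
  morphisms hinf_apply Abs_hinf
  by (rule exI[of _ "\<lambda>_. 0"]) (auto simp: bounded_iff)

setup_lifting type_definition_hinf

lemma hinf_holomorphic: "hinf_apply f holomorphic_on unit_disc"
  using hinf_apply[of f] by auto

lemma hinf_outside: "z \<notin> unit_disc \<Longrightarrow> hinf_apply f z = 0"
  using hinf_apply[of f] by auto

lemma hinf_eqI:
  assumes "\<And>z. z \<in> unit_disc \<Longrightarrow> hinf_apply f z = hinf_apply g z"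
  shows "f = g"
proof (unfold hinf_apply_inject[symmetric], rule ext)
  show "hinf_apply f z = hinf_apply g z" for z
    by (cases "z \<in> unit_disc") (use assms in \<open>auto simp del: mem_ball simp: hinf_outside\<close>)
qed

lemma bounded_scaled_image:
  fixes f :: "complex \<Rightarrow> complex"
  assumes "bounded (f ` S)"
  shows "bounded ((\<lambda>z. c * f z) ` S)"
proof -
  obtain B where "\<forall>z\<in>S. cmod (f z) \<le> B"
    using assms by (auto simp: bounded_iff)
  then have "\<forall>z\<in>S. cmod (c * f z) \<le> cmod c * B"
    by (auto simp: norm_mult intro: mult_left_mono)
  then show ?thesis
    by (auto simp: bounded_iff)
qed

instantiation hinf :: real_vector
begin

lift_definition zero_hinf :: hinf is "\<lambda>_. 0"
  by (auto simp: bounded_iff)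

lift_definition plus_hinf :: "hinf \<Rightarrow> hinf \<Rightarrow> hinf" is "\<lambda>f g z. f z + g z"
  by (auto intro!: holomorphic_intros bounded_plus_comp)

lift_definition uminus_hinf :: "hinf \<Rightarrow> hinf" is "\<lambda>f z. - f z"
  by (auto intro!: holomorphic_intros simp: bounded_iff)

lift_definition minus_hinf :: "hinf \<Rightarrow> hinf \<Rightarrow> hinf" is "\<lambda>f g z. f z - g z"
  by (auto intro!: holomorphic_intros bounded_minus_comp)

lift_definition scaleR_hinf :: "real \<Rightarrow> hinf \<Rightarrow> hinf" is "\<lambda>r f z. complex_of_real r * f z"
  by (auto intro!: holomorphic_intros bounded_scaled_image)

instance
  by standard (transfer; auto simp: algebra_simps)+

end

lemma hinf_apply_add: "hinf_apply (f + g) z = hinf_apply f z + hinf_apply g z"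
  by transfer simp

lemma hinf_apply_diff: "hinf_apply (f - g) z = hinf_apply f z - hinf_apply g z"
  by transfer simp

lemma hinf_apply_scaleR: "hinf_apply (r *\<^sub>R f) z = complex_of_real r * hinf_apply f z"
  by transfer simp

lemma hinf_apply_zero: "hinf_apply 0 z = 0"
  by transfer simp

instantiation hinf :: real_normed_vector
begin

definition norm_hinf :: "hinf \<Rightarrow> real" where
  "norm_hinf f = (SUP z\<in>unit_disc. cmod (hinf_apply f z))"

definition dist_hinf :: "hinf \<Rightarrow> hinf \<Rightarrow> real" where
  "dist_hinf f g = norm (f - g)"

definition sgn_hinf :: "hinf \<Rightarrow> hinf" where
  "sgn_hinf f = f /\<^sub>R norm f"

definition uniformity_hinf :: "(hinf \<times> hinf) filter" where
  "uniformity_hinf = (INF e\<in>{0<..}. principal {(f, g). dist f g < e})"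

definition open_hinf :: "hinf set \<Rightarrow> bool" where
  "open_hinf U \<longleftrightarrow> (\<forall>f\<in>U. eventually (\<lambda>(f', g). f' = f \<longrightarrow> g \<in> U) uniformity)"

lemma cmod_le_norm_hinf: "cmod (hinf_apply f z) \<le> norm f"
proof -
  have bdd: "bdd_above ((\<lambda>z. cmod (hinf_apply f z)) ` unit_disc)"
    using hinf_apply[of f] by (auto simp: bounded_iff bdd_above_def)
  have le: "cmod (hinf_apply f w) \<le> norm f" if "w \<in> unit_disc" for w
    unfolding norm_hinf_def by (rule cSUP_upper[OF that bdd])
  show ?thesis
  proof (cases "z \<in> unit_disc")
    case False
    then have "cmod (hinf_apply f z) = 0"
      by (subst hinf_outside) auto
    also have "0 \<le> norm f"
      by (rule order_trans[OF norm_ge_zero le[of 0]]) simp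
    finally show ?thesis .
  qed (rule le)
qed

lemma norm_hinf_le:
  assumes "\<And>z. z \<in> unit_disc \<Longrightarrow> cmod (hinf_apply f z) \<le> B"
  shows "norm f \<le> B"
  unfolding norm_hinf_def by (rule cSUP_least) (use assms in auto)

lemma norm_hinf_scaled:
  assumes "\<And>z. hinf_apply g z = c * hinf_apply f z"
  shows "norm g = cmod c * norm f"
proof (rule antisym)
  show "norm g \<le> cmod c * norm f"
    by (rule norm_hinf_le) (simp only: assms norm_mult mult_left_mono[OF cmod_le_norm_hinf norm_ge_zero])
  show "cmod c * norm f \<le> norm g"
  proof (cases "c = 0")
    case True
    have "0 \<le> norm g"
      by (rule order_trans[OF norm_ge_zero cmod_le_norm_hinf])
    then show ?thesis
      using True by simp
  next
    case False
    have "norm f \<le> norm g / cmod c"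
    proof (rule norm_hinf_le)
      fix z
      show "cmod (hinf_apply f z) \<le> norm g / cmod c"
        using cmod_le_norm_hinf[of g z] False
        by (simp add: assms norm_mult pos_le_divide_eq mult.commute)
    qed
    then show ?thesis
      using False by (simp add: pos_le_divide_eq mult.commute)
  qed
qed

instance
proof
  fix f g :: hinf and r :: real
  show "dist f g = norm (f - g)" by (rule dist_hinf_def)
  show "sgn f = f /\<^sub>R norm f" by (rule sgn_hinf_def)
  show "(uniformity :: (hinf \<times> hinf) filter) = (INF e\<in>{0<..}. principal {(x, y). dist x y < e})"
    by (rule uniformity_hinf_def)
  show "open U \<longleftrightarrow> (\<forall>x\<in>U. \<forall>\<^sub>F (x', y) in uniformity. x' = x \<longrightarrow> y \<in> U)" for U :: "hinf set"
    by (rule open_hinf_def)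
  show "norm f = 0 \<longleftrightarrow> f = 0"
  proof
    assume "norm f = 0"
    then have "hinf_apply f z = 0" for z
      using cmod_le_norm_hinf[of f z] by simp
    then show "f = 0"
      by (intro hinf_eqI) (simp add: hinf_apply_zero)
  qed (simp add: norm_hinf_def hinf_apply_zero)
  show "norm (f + g) \<le> norm f + norm g"
    by (rule norm_hinf_le)
       (simp only: hinf_apply_add norm_triangle_le[OF add_mono[OF cmod_le_norm_hinf cmod_le_norm_hinf]])
  show "norm (r *\<^sub>R f) = \<bar>r\<bar> * norm f"
    by (subst norm_hinf_scaled[OF hinf_apply_scaleR]) (simp only: norm_of_real)
qed

end

instance hinf :: banach
proof
  fix X :: "nat \<Rightarrow> hinf"
  assume X: "Cauchy X"
  define g where "g z = lim (\<lambda>n. hinf_apply (X n) z)" for z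
  have "uniformly_Cauchy_on UNIV (\<lambda>n. hinf_apply (X n))"
    unfolding uniformly_Cauchy_on_def
  proof (intro allI impI)
    fix e :: real
    assume "e > 0"
    then obtain M where M: "\<And>m n. m \<ge> M \<Longrightarrow> n \<ge> M \<Longrightarrow> norm (X m - X n) < e"
      using X CauchyD by blast
    show "\<exists>M. \<forall>x\<in>UNIV. \<forall>m\<ge>M. \<forall>n\<ge>M. dist (hinf_apply (X m) x) (hinf_apply (X n) x) < e"
    proof (intro exI[of _ M] ballI allI impI)
      fix x m n
      assume "m \<ge> M" "n \<ge> M"
      then show "dist (hinf_apply (X m) x) (hinf_apply (X n) x) < e"
        using M[of m n] cmod_le_norm_hinf[of "X m - X n" x] by (simp add: dist_norm hinf_apply_diff)
    qed
  qed
  then have ul: "uniform_limit UNIV (\<lambda>n. hinf_apply (X n)) g sequentially"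
    unfolding g_def
    using Cauchy_uniformly_convergent uniformly_convergent_uniform_limit_iff by blast
  have hol: "g holomorphic_on unit_disc"
  proof (rule holomorphic_uniform_sequence[where f = "\<lambda>n. hinf_apply (X n)"])
    fix x :: complex
    assume "x \<in> unit_disc"
    then obtain d where d: "d > 0" "cball x d \<subseteq> unit_disc"
      by (meson open_ball open_contains_cball)
    then show "\<exists>d>0. cball x d \<subseteq> unit_disc \<and>
        uniform_limit (cball x d) (\<lambda>n. hinf_apply (X n)) g sequentially"
      by (intro exI[of _ d] conjI uniform_limit_on_subset[OF ul] subset_UNIV)
  qed (auto intro: hinf_holomorphic)
  have lim: "(\<lambda>n. hinf_apply (X n) z) \<longlonglongrightarrow> g z" for z
    by (rule tendsto_uniform_limitI[OF ul UNIV_I])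
  have outside: "g z = 0" if "z \<notin> unit_disc" for z
    using lim[of z] unfolding hinf_outside[OF that] LIMSEQ_const_iff by (rule sym)
  have bdd: "bounded (g ` unit_disc)"
  proof -
    obtain B where B: "\<And>n. norm (X n) \<le> B"
      using cauchy_imp_bounded[OF X] unfolding bounded_iff by blast
    have "cmod (g z) \<le> B" for z
    proof (rule LIMSEQ_le_const2[OF tendsto_norm[OF lim]])
      show "\<exists>N. \<forall>n\<ge>N. cmod (hinf_apply (X n) z) \<le> B"
        by (intro exI allI impI order_trans[OF cmod_le_norm_hinf B])
    qed
    then show ?thesis
      unfolding bounded_iff by blast
  qed
  have app: "hinf_apply (Abs_hinf g) = g"
    by (rule Abs_hinf_inverse) (intro CollectI conjI allI impI hol bdd outside)
  have "X \<longlonglongrightarrow> Abs_hinf g"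
  proof (rule LIMSEQ_I)
    fix e :: real
    assume "e > 0"
    then have "\<forall>\<^sub>F n in sequentially. \<forall>x\<in>UNIV. dist (hinf_apply (X n) x) (g x) < e / 2"
      by (intro uniform_limitD[OF ul] half_gt_zero)
    then obtain N where N: "\<And>n x. n \<ge> N \<Longrightarrow> dist (hinf_apply (X n) x) (g x) < e / 2"
      unfolding eventually_sequentially by blast
    show "\<exists>N. \<forall>n\<ge>N. norm (X n - Abs_hinf g) < e"
    proof (intro exI[of _ N] allI impI)
      fix n
      assume n: "n \<ge> N"
      have "norm (X n - Abs_hinf g) \<le> e / 2"
        using less_imp_le[OF N[OF n]]
        by (intro norm_hinf_le) (simp only: hinf_apply_diff app dist_norm)
      then show "norm (X n - Abs_hinf g) < e"
        using \<open>e > 0\<close> by simp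
    qed
  qed
  then show "convergent X"
    by (auto simp: convergent_def)
qed

instantiation hinf :: complex_banach
begin

lift_definition scaleC_hinf :: "complex \<Rightarrow> hinf \<Rightarrow> hinf" is "\<lambda>c f z. c * f z"
  by (auto intro!: holomorphic_intros bounded_scaled_image)

instance
proof
  fix c d :: complex and f g :: hinf and r :: real
  show "c *\<^sub>C (f + g) = c *\<^sub>C f + c *\<^sub>C g" by transfer (auto simp: algebra_simps)
  show "(c + d) *\<^sub>C f = c *\<^sub>C f + d *\<^sub>C f" by transfer (auto simp: algebra_simps)
  show "c *\<^sub>C d *\<^sub>C f = (c * d) *\<^sub>C f" by transfer (auto simp: algebra_simps)
  show "complex_of_real r *\<^sub>C f = r *\<^sub>R f" by transfer auto
  show "norm (c *\<^sub>C f) = cmod c * norm f"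
    by (rule norm_hinf_scaled) (transfer, auto)
qed

end

lemma hinf_apply_scaleC: "hinf_apply (c *\<^sub>C f) z = c * hinf_apply f z"
  by transfer simp


section \<open>The disc algebra\<close>

definition extends_continuously :: "hinf \<Rightarrow> bool" where
  "extends_continuously f \<longleftrightarrow>
     (\<exists>g. continuous_on (closure unit_disc) g \<and> (\<forall>z\<in>unit_disc. g z = hinf_apply f z))"

text \<open>A continuous function on the closed disc is bounded, so carving the disc algebra out of
  \<open>hinf\<close> loses no functions.\<close>

typedef disc_algebra = "{f :: hinf. extends_continuously f}"
  morphisms disc_to_hinf Abs_disc_algebra
  by (rule exI[of _ 0]) (auto simp: extends_continuously_def hinf_apply_zero intro!: exI[of _ "\<lambda>_. 0"])

setup_lifting type_definition_disc_algebra

lemma uniformly_continuous_on_uniform_limit: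
  fixes f :: "nat \<Rightarrow> 'a::metric_space \<Rightarrow> 'b::metric_space"
  assumes lim: "uniform_limit S f g sequentially"
    and cont: "\<And>n. uniformly_continuous_on S (f n)"
  shows "uniformly_continuous_on S g"
  unfolding uniformly_continuous_on_def
proof (intro allI impI)
  fix e :: real
  assume "e > 0"
  then have "\<forall>\<^sub>F n in sequentially. \<forall>x\<in>S. dist (f n x) (g x) < e / 3"
    using lim unfolding uniform_limit_iff by (meson divide_pos_pos zero_less_numeral)
  then obtain n where "\<forall>x\<in>S. dist (f n x) (g x) < e / 3"
    using eventually_happens'[OF sequentially_bot] by blast
  then have n: "\<And>x. x \<in> S \<Longrightarrow> dist (f n x) (g x) < e / 3"
    by (rule bspec)
  have "e / 3 > 0" using \<open>e > 0\<close> by simp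
  then obtain d where d: "d > 0" "\<forall>x\<in>S. \<forall>y\<in>S. dist y x < d \<longrightarrow> dist (f n y) (f n x) < e / 3"
    using cont[of n] unfolding uniformly_continuous_on_def by blast
  show "\<exists>d>0. \<forall>x\<in>S. \<forall>y\<in>S. dist y x < d \<longrightarrow> dist (g y) (g x) < e"
  proof (intro exI[of _ d] conjI ballI impI d(1))
    fix x y
    assume xy: "x \<in> S" "y \<in> S" "dist y x < d"
    have "dist (g y) (f n y) < e / 3"
      using n[OF xy(2)] by (simp add: dist_commute)
    moreover have "dist (g y) (g x) \<le> dist (g y) (f n y) + dist (f n y) (f n x) + dist (f n x) (g x)"
      by (meson add_mono dist_triangle order_refl order_trans)
    ultimately show "dist (g y) (g x) < e"
      using n[OF xy(1)] d(2)[rule_format, OF xy] by linarith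
  qed
qed

lemma extends_continuously_iff_uniformly:
  "extends_continuously f \<longleftrightarrow> uniformly_continuous_on unit_disc (hinf_apply f)"
proof
  assume "extends_continuously f"
  then obtain g where g: "continuous_on (closure unit_disc) g" "\<forall>z\<in>unit_disc. g z = hinf_apply f z"
    by (auto simp: extends_continuously_def)
  have "uniformly_continuous_on (closure unit_disc) g"
    by (rule compact_uniformly_continuous[OF g(1)]) auto
  then have "uniformly_continuous_on unit_disc g"
    using closure_subset[of unit_disc] unfolding uniformly_continuous_on_def by (meson subsetD)
  then show "uniformly_continuous_on unit_disc (hinf_apply f)"
    using g(2) by (simp add: uniformly_continuous_on_def)
next
  assume "uniformly_continuous_on unit_disc (hinf_apply f)"
  then obtain g where "uniformly_continuous_on (closure unit_disc) g"
      "\<And>x. x \<in> unit_disc \<Longrightarrow> hinf_apply f x = g x"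
    by (rule uniformly_continuous_on_extension_on_closure) blast
  then show "extends_continuously f"
    unfolding extends_continuously_def by (metis uniformly_continuous_imp_continuous)
qed

lemma extends_continuously_scaled:
  assumes "extends_continuously f" "\<And>z. hinf_apply g z = c * hinf_apply f z"
  shows "extends_continuously g"
proof -
  obtain h where h: "continuous_on (closure unit_disc) h" "\<forall>z\<in>unit_disc. h z = hinf_apply f z"
    using assms(1) by (auto simp: extends_continuously_def)
  show ?thesis
    unfolding extends_continuously_def
    by (rule exI[of _ "\<lambda>z. c * h z"]) (use h assms(2) in \<open>auto intro!: continuous_intros\<close>)
qed

lemma extends_continuously_add:
  assumes "extends_continuously f" "extends_continuously g"
  shows "extends_continuously (f + g)"
proof -
  obtain h where h: "continuous_on (closure unit_disc) h" "\<forall>z\<in>unit_disc. h z = hinf_apply f z"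
    using assms(1) by (auto simp: extends_continuously_def)
  obtain k where k: "continuous_on (closure unit_disc) k" "\<forall>z\<in>unit_disc. k z = hinf_apply g z"
    using assms(2) by (auto simp: extends_continuously_def)
  show ?thesis
    unfolding extends_continuously_def
    by (rule exI[of _ "\<lambda>z. h z + k z"]) (use h k in \<open>auto intro!: continuous_intros simp: hinf_apply_add\<close>)
qed

instantiation disc_algebra :: real_vector
begin

lift_definition zero_disc_algebra :: disc_algebra is "0 :: hinf"
  by (auto simp: extends_continuously_def hinf_apply_zero intro!: exI[of _ "\<lambda>_. 0"])

lift_definition plus_disc_algebra :: "disc_algebra \<Rightarrow> disc_algebra \<Rightarrow> disc_algebra"
  is "\<lambda>f g :: hinf. f + g"
  by (rule extends_continuously_add)

lift_definition uminus_disc_algebra :: "disc_algebra \<Rightarrow> disc_algebra" is "\<lambda>f :: hinf. - f"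
  by (erule extends_continuously_scaled[where c = "-1"]) (transfer, simp)

lift_definition minus_disc_algebra :: "disc_algebra \<Rightarrow> disc_algebra \<Rightarrow> disc_algebra"
  is "\<lambda>f g :: hinf. f - g"
proof -
  fix f g :: hinf
  assume f: "extends_continuously f" and g: "extends_continuously g"
  have "extends_continuously (- g)"
    using g by (rule extends_continuously_scaled[where c = "-1"]) (transfer, simp)
  then show "extends_continuously (f - g)"
    using extends_continuously_add[OF f] by fastforce
qed

lift_definition scaleR_disc_algebra :: "real \<Rightarrow> disc_algebra \<Rightarrow> disc_algebra"
  is "\<lambda>r (f :: hinf). r *\<^sub>R f"
  by (erule extends_continuously_scaled) (rule hinf_apply_scaleR)

instance
  by standard (transfer; auto simp: algebra_simps)+

end

instantiation disc_algebra :: real_normed_vector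
begin

lift_definition norm_disc_algebra :: "disc_algebra \<Rightarrow> real" is "norm :: hinf \<Rightarrow> real" .

definition dist_disc_algebra :: "disc_algebra \<Rightarrow> disc_algebra \<Rightarrow> real" where
  "dist_disc_algebra f g = norm (f - g)"

definition sgn_disc_algebra :: "disc_algebra \<Rightarrow> disc_algebra" where
  "sgn_disc_algebra f = f /\<^sub>R norm f"

definition uniformity_disc_algebra :: "(disc_algebra \<times> disc_algebra) filter" where
  "uniformity_disc_algebra = (INF e\<in>{0<..}. principal {(f, g). dist f g < e})"

definition open_disc_algebra :: "disc_algebra set \<Rightarrow> bool" where
  "open_disc_algebra U \<longleftrightarrow> (\<forall>f\<in>U. eventually (\<lambda>(f', g). f' = f \<longrightarrow> g \<in> U) uniformity)"

instance
proof
  fix f g :: disc_algebra and r :: real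
  show "dist f g = norm (f - g)" by (rule dist_disc_algebra_def)
  show "sgn f = f /\<^sub>R norm f" by (rule sgn_disc_algebra_def)
  show "(uniformity :: (disc_algebra \<times> disc_algebra) filter) =
      (INF e\<in>{0<..}. principal {(x, y). dist x y < e})"
    by (rule uniformity_disc_algebra_def)
  show "open U \<longleftrightarrow> (\<forall>x\<in>U. \<forall>\<^sub>F (x', y) in uniformity. x' = x \<longrightarrow> y \<in> U)"
    for U :: "disc_algebra set"
    by (rule open_disc_algebra_def)
  show "norm f = 0 \<longleftrightarrow> f = 0" by transfer simp
  show "norm (f + g) \<le> norm f + norm g" by transfer (rule norm_triangle_ineq)
  show "norm (r *\<^sub>R f) = \<bar>r\<bar> * norm f" by transfer simp
qed

end

lemma disc_to_hinf_diff: "disc_to_hinf (f - g) = disc_to_hinf f - disc_to_hinf g"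
  by transfer simp

lemma norm_disc_to_hinf: "norm (disc_to_hinf f) = norm f"
  by transfer simp

lemma closed_extends_continuously: "closed {f. extends_continuously f}"
proof (unfold closed_sequential_limits, intro allI impI, elim conjE)
  fix X and f :: hinf
  assume X: "\<forall>n. X n \<in> {f. extends_continuously f}" and lim: "X \<longlonglongrightarrow> f"
  have "uniform_limit unit_disc (\<lambda>n. hinf_apply (X n)) (hinf_apply f) sequentially"
    unfolding uniform_limit_iff
  proof (intro allI impI)
    fix e :: real
    assume "e > 0"
    then have "\<forall>\<^sub>F n in sequentially. norm (X n - f) < e"
      using lim by (auto simp: tendsto_iff dist_norm)
    then show "\<forall>\<^sub>F n in sequentially. \<forall>x\<in>unit_disc. dist (hinf_apply (X n) x) (hinf_apply f x) < e"
    proof eventually_elim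
      case (elim n)
      then show ?case
        using cmod_le_norm_hinf[of "X n - f"] by (auto simp: dist_norm hinf_apply_diff intro: le_less_trans)
    qed
  qed
  moreover have "uniformly_continuous_on unit_disc (hinf_apply (X n))" for n
    using X by (simp flip: extends_continuously_iff_uniformly)
  ultimately show "f \<in> {f. extends_continuously f}"
    by (simp add: extends_continuously_iff_uniformly uniformly_continuous_on_uniform_limit)
qed

instance disc_algebra :: banach
proof
  fix X :: "nat \<Rightarrow> disc_algebra"
  assume X: "Cauchy X"
  have "Cauchy (\<lambda>n. disc_to_hinf (X n))"
    using X by (simp add: Cauchy_def dist_norm norm_disc_to_hinf flip: disc_to_hinf_diff)
  then obtain f where f: "(\<lambda>n. disc_to_hinf (X n)) \<longlonglongrightarrow> f"
    unfolding Cauchy_convergent_iff convergent_def by (elim exE)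
  then have "extends_continuously f"
    using closed_sequentially[OF closed_extends_continuously _ f] disc_to_hinf by simp
  then have "disc_to_hinf (Abs_disc_algebra f) = f"
    by (simp add: Abs_disc_algebra_inverse)
  then have "norm (X n - Abs_disc_algebra f) = norm (disc_to_hinf (X n) - f)" for n
    by (metis disc_to_hinf_diff norm_disc_to_hinf)
  then have "X \<longlonglongrightarrow> Abs_disc_algebra f"
    using f by (simp add: tendsto_iff dist_norm)
  then show "convergent X"
    by (auto simp: convergent_def)
qed

instantiation disc_algebra :: complex_banach
begin

lift_definition scaleC_disc_algebra :: "complex \<Rightarrow> disc_algebra \<Rightarrow> disc_algebra"
  is "\<lambda>c (f :: hinf). c *\<^sub>C f"
  by (erule extends_continuously_scaled) (rule hinf_apply_scaleC)

instance
  by standard (transfer; auto simp: scaleC_add_right scaleC_add_left scaleC_scaleC scaleC_of_real norm_scaleC)+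

end


section \<open>The generalized Cesaro operators\<close>

definition Cesaro :: "real \<Rightarrow> (complex \<Rightarrow> complex) \<Rightarrow> complex \<Rightarrow> complex" where
  "Cesaro t f z =
     (if z \<notin> unit_disc then 0
      else if z = 0 then f 0
      else (1 / z) * contour_integral (linepath 0 z) (\<lambda>\<xi>. f \<xi> / (1 - of_real t * \<xi>)))"

text \<open>
  \<open>Abs_hinf\<close>, \<open>Abs_disc_algebra\<close> and \<open>Blinfun\<close> only turn \<open>Cesaro t\<close> into an element of the respective
  operator space; for \<open>t \<in> [0,1)\<close> this is justified by the lemmas \<open>Cesaro_hinf_apply\<close> and
  \<open>Cesaro_disc_apply\<close> below.
\<close>

definition Cesaro_hinf :: "real \<Rightarrow> (hinf \<Rightarrow>\<^sub>L hinf)" where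
  "Cesaro_hinf t = Blinfun (\<lambda>f. Abs_hinf (Cesaro t (hinf_apply f)))"

definition Cesaro_disc :: "real \<Rightarrow> (disc_algebra \<Rightarrow>\<^sub>L disc_algebra)" where
  "Cesaro_disc t =
     Blinfun (\<lambda>f. Abs_disc_algebra (Abs_hinf (Cesaro t (hinf_apply (disc_to_hinf f)))))"

context
  fixes t :: real
  assumes t: "0 \<le> t" "t < 1"
begin

lemma denom_lower: "z \<in> unit_disc \<Longrightarrow> 1 - t \<le> cmod (1 - of_real t * z)"
proof -
  assume "z \<in> unit_disc"
  then have "cmod (of_real t * z) \<le> t"
    using t by (simp add: norm_mult mult_left_le)
  moreover have "1 - cmod (of_real t * z) \<le> cmod (1 - of_real t * z)"
    using norm_triangle_ineq2[of 1 "of_real t * z"] by simp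
  ultimately show ?thesis by simp
qed

lemma denom_nonzero: "z \<in> unit_disc \<Longrightarrow> 1 - of_real t * z \<noteq> 0"
  using denom_lower[of z] t by (metis diff_gt_0_iff_gt less_le_trans norm_zero less_irrefl)

lemma integrand_holomorphic:
  "f holomorphic_on unit_disc \<Longrightarrow> (\<lambda>\<xi>. f \<xi> / (1 - of_real t * \<xi>)) holomorphic_on unit_disc"
  using denom_nonzero by (auto intro!: holomorphic_intros)

lemma integrand_bound:
  assumes "z \<in> unit_disc"
  shows "cmod (hinf_apply f z / (1 - of_real t * z)) \<le> norm f / (1 - t)"
  using denom_lower[OF assms] t cmod_le_norm_hinf[of f z]
  by (auto simp: norm_divide intro!: frac_le)

lemma Cesaro_primitive:
  assumes "f holomorphic_on unit_disc"
  obtains F where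
    "\<And>z. z \<in> unit_disc \<Longrightarrow> (F has_field_derivative f z / (1 - of_real t * z)) (at z)"
    "F 0 = 0"
    "\<And>z. z \<in> unit_disc \<Longrightarrow>
       ((\<lambda>\<xi>. f \<xi> / (1 - of_real t * \<xi>)) has_contour_integral F z) (linepath 0 z)"
    "\<And>z. z \<in> unit_disc \<Longrightarrow> z \<noteq> 0 \<Longrightarrow> Cesaro t f z = F z / z"
proof -
  obtain G where G: "\<And>z. z \<in> unit_disc \<Longrightarrow>
      (G has_field_derivative f z / (1 - of_real t * z)) (at z within unit_disc)"
    using holomorphic_convex_primitive'[OF convex_ball open_ball integrand_holomorphic[OF assms]]
    by blast
  define F where "F z = G z - G 0" for z
  have F: "(F has_field_derivative f z / (1 - of_real t * z)) (at z within unit_disc)"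
    if "z \<in> unit_disc" for z
    unfolding F_def using G[OF that] by (auto intro!: derivative_eq_intros)
  have int: "((\<lambda>\<xi>. f \<xi> / (1 - of_real t * \<xi>)) has_contour_integral F z) (linepath 0 z)"
    if "z \<in> unit_disc" for z
  proof -
    have "closed_segment 0 z \<subseteq> unit_disc"
      using that by (intro closed_segment_subset) auto
    then show ?thesis
      using contour_integral_primitive[OF F, of "linepath 0 z"] by (simp add: F_def)
  qed
  show thesis
  proof (rule that[of F])
    show "(F has_field_derivative f z / (1 - of_real t * z)) (at z)" if "z \<in> unit_disc" for z
      using F[OF that] at_within_open[OF that open_ball] by simp
    show "F 0 = 0" by (simp add: F_def)
    show "Cesaro t f z = F z / z" if "z \<in> unit_disc" "z \<noteq> 0" for z
      using that contour_integral_unique[OF int[OF that(1)]] by (simp add: Cesaro_def)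
  qed (rule int)
qed

lemma Cesaro_holomorphic:
  assumes "f holomorphic_on unit_disc"
  shows "Cesaro t f holomorphic_on unit_disc"
proof -
  obtain F where F: "\<And>z. z \<in> unit_disc \<Longrightarrow> (F has_field_derivative f z / (1 - of_real t * z)) (at z)"
    "F 0 = 0" "\<And>z. z \<in> unit_disc \<Longrightarrow> z \<noteq> 0 \<Longrightarrow> Cesaro t f z = F z / z"
    using Cesaro_primitive[OF assms] by metis
  show ?thesis
  proof (rule pole_theorem_open_0[where g = F and a = 0])
    show "F holomorphic_on unit_disc"
      using F(1) by (meson holomorphic_on_open open_ball)
    show "Cesaro t f 0 = deriv F 0"
      using DERIV_imp_deriv[OF F(1)[of 0]] by (simp add: Cesaro_def)
  qed (use F in auto)
qed

lemma Cesaro_bound: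
  assumes "z \<in> unit_disc"
  shows "cmod (Cesaro t (hinf_apply f) z) \<le> norm f / (1 - t)"
proof (cases "z = 0")
  case True
  then show ?thesis
    using integrand_bound[of 0 f] by (simp add: Cesaro_def)
next
  case False
  obtain F where F:
    "((\<lambda>\<xi>. hinf_apply f \<xi> / (1 - of_real t * \<xi>)) has_contour_integral F) (linepath 0 z)"
    "Cesaro t (hinf_apply f) z = F / z"
    using Cesaro_primitive[OF hinf_holomorphic[of f]] assms False by metis
  have sub: "closed_segment 0 z \<subseteq> unit_disc"
    using assms by (intro closed_segment_subset) auto
  have "cmod F \<le> norm f / (1 - t) * cmod (z - 0)"
    using F(1)
  proof (rule has_contour_integral_bound_linepath)
    show "0 \<le> norm f / (1 - t)" using t by simp
  qed (use sub integrand_bound in blast)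
  then show ?thesis
    using False F(2) by (simp add: norm_divide divide_le_eq)
qed

lemma Cesaro_in_hinf: "hinf_apply (Abs_hinf (Cesaro t (hinf_apply f))) = Cesaro t (hinf_apply f)"
proof (rule Abs_hinf_inverse)
  have "bounded (Cesaro t (hinf_apply f) ` unit_disc)"
    using Cesaro_bound unfolding bounded_iff by blast
  then show "Cesaro t (hinf_apply f) \<in> {f. f holomorphic_on unit_disc \<and> bounded (f ` unit_disc) \<and>
      (\<forall>z. z \<notin> unit_disc \<longrightarrow> f z = 0)}"
    using Cesaro_holomorphic[OF hinf_holomorphic] by (auto simp: Cesaro_def)
qed

lemma Cesaro_extends: "extends_continuously f \<Longrightarrow>
  extends_continuously (Abs_hinf (Cesaro t (hinf_apply f)))"
proof -
  let ?g = "Cesaro t (hinf_apply f)" and ?M = "norm f / (1 - t)"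
  obtain F where F: "\<And>z. z \<in> unit_disc \<Longrightarrow>
      (F has_field_derivative hinf_apply f z / (1 - of_real t * z)) (at z)"
    "F 0 = 0" "\<And>z. z \<in> unit_disc \<Longrightarrow> z \<noteq> 0 \<Longrightarrow> ?g z = F z / z"
    using Cesaro_primitive[OF hinf_holomorphic[of f]] by metis
  have lip: "cmod (F x - F y) \<le> ?M * cmod (x - y)" if "x \<in> unit_disc" "y \<in> unit_disc" for x y
    by (rule field_differentiable_bound[OF convex_ball])
       (use F(1) has_field_derivative_at_within integrand_bound that in blast)+
  have M: "?M \<ge> 0" using t by simp
  have "uniformly_continuous_on unit_disc F"
    by (rule lipschitz_on_uniformly_continuous[of ?M])
       (use lip M in \<open>auto intro!: lipschitz_onI simp: dist_norm\<close>)
  then obtain G where G: "uniformly_continuous_on (closure unit_disc) G"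
    "\<And>z. z \<in> unit_disc \<Longrightarrow> F z = G z"
    by (rule uniformly_continuous_on_extension_on_closure) blast
  define h where "h z = (if z \<in> unit_disc then ?g z else G z / z)" for z
  have "continuous_on (closure unit_disc) h"
    unfolding continuous_on_eq_continuous_within
  proof
    fix z :: complex
    assume z: "z \<in> closure unit_disc"
    show "continuous (at z within closure unit_disc) h"
    proof (cases "z = 0")
      case True
      have "continuous_on unit_disc ?g"
        by (rule holomorphic_on_imp_continuous_on[OF Cesaro_holomorphic[OF hinf_holomorphic]])
      then have "continuous_on unit_disc h"
        by (rule continuous_on_eq) (simp add: h_def)
      then have "isCont h 0"
        by (simp add: continuous_on_eq_continuous_at)
      then show ?thesis
        using True continuous_at_imp_continuous_at_within by blast
    next
      case False
      have eq: "h w = G w / w" if "w \<noteq> 0" for w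
        using that F(3)[of w] G(2)[of w] by (auto simp: h_def)
      have "continuous_on (closure unit_disc - {0}) (\<lambda>w. G w / w)"
        by (intro continuous_intros continuous_on_subset[OF uniformly_continuous_imp_continuous[OF G(1)]])
           auto
      then have "continuous_on (closure unit_disc - {0}) h"
        by (rule continuous_on_eq) (simp add: eq)
      then have "continuous (at z within (closure unit_disc - {0})) h"
        using z False by (simp add: continuous_on_eq_continuous_within)
      moreover have "at z within (closure unit_disc - {0}) = at z within closure unit_disc"
        by (rule at_within_nhd[of _ "- {0}"]) (use False in auto)
      ultimately show ?thesis by simp
    qed
  qed
  then show ?thesis
    unfolding extends_continuously_def Cesaro_in_hinf
    by (intro exI[of _ h]) (simp add: h_def)
qed

lemma Cesaro_add:
  assumes "f holomorphic_on unit_disc" "g holomorphic_on unit_disc"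
  shows "Cesaro t (\<lambda>z. f z + g z) z = Cesaro t f z + Cesaro t g z"
proof (cases "z \<in> unit_disc")
  case True
  have "\<exists>F. ((\<lambda>\<xi>. h \<xi> / (1 - of_real t * \<xi>)) has_contour_integral F) (linepath 0 z)"
    if "h holomorphic_on unit_disc" for h
    using Cesaro_primitive[OF that] True by metis
  then have "(\<lambda>\<xi>. f \<xi> / (1 - of_real t * \<xi>)) contour_integrable_on linepath 0 z"
    "(\<lambda>\<xi>. g \<xi> / (1 - of_real t * \<xi>)) contour_integrable_on linepath 0 z"
    using assms by (auto simp: contour_integrable_on_def)
  then show ?thesis
    by (simp add: Cesaro_def add_divide_distrib contour_integral_add)
qed (simp add: Cesaro_def)

lemma Cesaro_cmul:
  assumes "f holomorphic_on unit_disc"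
  shows "Cesaro t (\<lambda>z. c * f z) z = c * Cesaro t f z"
proof (cases "z \<in> unit_disc")
  case True
  have "\<exists>F. ((\<lambda>\<xi>. f \<xi> / (1 - of_real t * \<xi>)) has_contour_integral F) (linepath 0 z)"
    using Cesaro_primitive[OF assms] True by metis
  then have "(\<lambda>\<xi>. f \<xi> / (1 - of_real t * \<xi>)) contour_integrable_on linepath 0 z"
    by (auto simp: contour_integrable_on_def)
  then have "contour_integral (linepath 0 z) (\<lambda>\<xi>. c * (f \<xi> / (1 - of_real t * \<xi>))) =
      c * contour_integral (linepath 0 z) (\<lambda>\<xi>. f \<xi> / (1 - of_real t * \<xi>))"
    by (rule contour_integral_lmul)
  then show ?thesis
    by (simp add: Cesaro_def)
qed (simp add: Cesaro_def)

lemma bounded_linear_Cesaro_hinf: "bounded_linear (\<lambda>f. Abs_hinf (Cesaro t (hinf_apply f)))"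
proof (rule bounded_linear_intro[where K = "1 / (1 - t)"])
  fix f g :: hinf and r :: real
  have *: "hinf_apply (f + g) = (\<lambda>z. hinf_apply f z + hinf_apply g z)"
    by (auto simp: hinf_apply_add)
  show "Abs_hinf (Cesaro t (hinf_apply (f + g))) =
      Abs_hinf (Cesaro t (hinf_apply f)) + Abs_hinf (Cesaro t (hinf_apply g))"
    by (intro hinf_eqI) (subst Cesaro_in_hinf, subst *,
        simp only: Cesaro_in_hinf hinf_apply_add Cesaro_add[OF hinf_holomorphic hinf_holomorphic])
  have **: "hinf_apply (r *\<^sub>R f) = (\<lambda>z. complex_of_real r * hinf_apply f z)"
    by (auto simp: hinf_apply_scaleR)
  show "Abs_hinf (Cesaro t (hinf_apply (r *\<^sub>R f))) = r *\<^sub>R Abs_hinf (Cesaro t (hinf_apply f))"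
    by (intro hinf_eqI) (subst Cesaro_in_hinf, subst **,
        simp only: Cesaro_in_hinf hinf_apply_scaleR Cesaro_cmul[OF hinf_holomorphic])
  show "norm (Abs_hinf (Cesaro t (hinf_apply f))) \<le> norm f * (1 / (1 - t))"
    by (rule norm_hinf_le) (use Cesaro_bound in \<open>simp add: Cesaro_in_hinf\<close>)
qed

lemma Cesaro_hinf_apply: "hinf_apply (blinfun_apply (Cesaro_hinf t) f) = Cesaro t (hinf_apply f)"
  unfolding Cesaro_hinf_def bounded_linear_Blinfun_apply[OF bounded_linear_Cesaro_hinf]
  by (rule Cesaro_in_hinf)

lemma Cesaro_hinf_scaleC:
  "blinfun_apply (Cesaro_hinf t) (c *\<^sub>C f) = c *\<^sub>C blinfun_apply (Cesaro_hinf t) f"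
proof -
  have *: "hinf_apply (c *\<^sub>C f) = (\<lambda>z. c * hinf_apply f z)"
    by (auto simp: hinf_apply_scaleC)
  show ?thesis
    by (intro hinf_eqI) (subst Cesaro_hinf_apply, subst *,
        simp only: hinf_apply_scaleC Cesaro_hinf_apply Cesaro_cmul[OF hinf_holomorphic])
qed

lemma Cesaro_in_disc:
  "disc_to_hinf (Abs_disc_algebra (Abs_hinf (Cesaro t (hinf_apply (disc_to_hinf f))))) =
   blinfun_apply (Cesaro_hinf t) (disc_to_hinf f)"
proof -
  have "extends_continuously (disc_to_hinf f)"
    using disc_to_hinf[of f] by simp
  then show ?thesis
    using Cesaro_extends[of "disc_to_hinf f"]
    by (simp add: Abs_disc_algebra_inverse Cesaro_hinf_def
        bounded_linear_Blinfun_apply[OF bounded_linear_Cesaro_hinf])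
qed

lemma bounded_linear_Cesaro_disc:
  "bounded_linear (\<lambda>f. Abs_disc_algebra (Abs_hinf (Cesaro t (hinf_apply (disc_to_hinf f)))))"
proof (rule bounded_linear_intro[where K = "norm (Cesaro_hinf t)"])
  fix f g :: disc_algebra and r :: real
  let ?T = "\<lambda>f. Abs_disc_algebra (Abs_hinf (Cesaro t (hinf_apply (disc_to_hinf f))))"
  have "disc_to_hinf (?T (f + g)) = disc_to_hinf (?T f + ?T g)"
    unfolding plus_disc_algebra.rep_eq[of "?T f"] Cesaro_in_disc
    by (simp add: plus_disc_algebra.rep_eq blinfun.add_right)
  then show "?T (f + g) = ?T f + ?T g" by (simp only: disc_to_hinf_inject)
  have "disc_to_hinf (?T (r *\<^sub>R f)) = disc_to_hinf (r *\<^sub>R ?T f)"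
    unfolding scaleR_disc_algebra.rep_eq[of _ "?T f"] Cesaro_in_disc
    by (simp add: scaleR_disc_algebra.rep_eq blinfun.scaleR_right)
  then show "?T (r *\<^sub>R f) = r *\<^sub>R ?T f" by (simp only: disc_to_hinf_inject)
  show "norm (?T f) \<le> norm f * norm (Cesaro_hinf t)"
    using norm_blinfun[of "Cesaro_hinf t" "disc_to_hinf f"]
    unfolding norm_disc_to_hinf[symmetric, of "?T f"] Cesaro_in_disc
    by (simp add: norm_disc_to_hinf mult.commute)
qed

lemma disc_to_hinf_Cesaro_disc:
  "disc_to_hinf (blinfun_apply (Cesaro_disc t) f) = blinfun_apply (Cesaro_hinf t) (disc_to_hinf f)"
  unfolding Cesaro_disc_def bounded_linear_Blinfun_apply[OF bounded_linear_Cesaro_disc]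
  by (rule Cesaro_in_disc)

lemma Cesaro_disc_apply:
  "hinf_apply (disc_to_hinf (blinfun_apply (Cesaro_disc t) f)) =
   Cesaro t (hinf_apply (disc_to_hinf f))"
  by (simp add: disc_to_hinf_Cesaro_disc Cesaro_hinf_apply)

lemma Cesaro_disc_scaleC:
  "blinfun_apply (Cesaro_disc t) (c *\<^sub>C f) = c *\<^sub>C blinfun_apply (Cesaro_disc t) f"
proof -
  have "disc_to_hinf (blinfun_apply (Cesaro_disc t) (c *\<^sub>C f)) =
      disc_to_hinf (c *\<^sub>C blinfun_apply (Cesaro_disc t) f)"
    by (simp add: disc_to_hinf_Cesaro_disc scaleC_disc_algebra.rep_eq Cesaro_hinf_scaleC)
  then show ?thesis by (simp add: disc_to_hinf_inject)
qed

end

end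

theory Submission
  imports Defs
begin

text \<open>
  The function \<open>h(z) = 1 / (1 - t z)\<close> is fixed by \<open>C\<^sub>t\<close>, and \<open>C\<^sub>t\<close> preserves the value at the
  origin.  So everything depends on the behaviour of \<open>C\<^sub>t\<close> on the complement of \<open>h\<close>, the functions
  vanishing at the origin, and there the iterates decay geometrically in operator norm.

  The decay comes from positivity.  Since \<open>C\<^sub>t f(z)\<close> is the integral of \<open>f(s z) / (1 - t s z)\<close> over
  \<open>0 \<le> s \<le> 1\<close> and \<open>\<bar>1 - t s z\<bar> \<ge> 1 - t s \<bar>z\<bar>\<close>, a radial bound \<open>\<bar>f(z)\<bar> \<le> w(\<bar>z\<bar>)\<close> implies
  \<open>\<bar>C\<^sub>t f(z)\<bar> \<le> (C\<^sub>t w)(\<bar>z\<bar>)\<close>.  The weight \<open>w(r) = r / (1 - t r)\<^sup>2\<close> is the eigenfunction of \<open>C\<^sub>t\<close> for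
  the eigenvalue \<open>1/2\<close>, so each application of \<open>C\<^sub>t\<close> halves a bound by a multiple of \<open>w\<close>
  (lemma \<open>Cesaro_halves_weight\<close>).  If \<open>g(0) = 0\<close>, the Schwarz lemma bounds \<open>\<bar>g(z)\<bar>\<close> by
  \<open>\<parallel>g\<parallel> \<bar>z\<bar> \<le> \<parallel>g\<parallel> w(\<bar>z\<bar>)\<close>, which starts the iteration; as \<open>w \<le> 1 / (1 - t)\<^sup>2\<close>, it ends with
  \<open>\<parallel>C\<^sub>t\<^sup>n g\<parallel> \<le> (1/2)\<^sup>n \<parallel>g\<parallel> / (1 - t)\<^sup>2\<close> (lemma \<open>Cesaro_hinf_power_decay\<close>).

  Hence \<open>C\<^sub>t\<^sup>n\<close> converges in operator norm, at a geometric rate, to the projection \<open>f \<mapsto> f(0) h\<close>.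
  This gives power boundedness and convergence of the Cesaro means.  Supercyclicity fails because
  along a projective orbit the norm of a vector is at most a constant times the modulus of its
  value at the origin, unless that value always vanishes; both alternatives are closed conditions
  and neither holds on the whole space.  The argument after the decay estimate is carried out for
  an abstract operator (lemma \<open>rank_one_attractor_dynamics\<close>); the disc algebra inherits the
  estimate through its isometric embedding into \<open>H\<^sup>\<infinity>\<close>, which intertwines the two operators.
\<close>

section \<open>Operators whose powers converge to a rank-one projection\<close>

lemma cesaro_mean_diff:
  assumes "n > 0"
  shows "cesaro_mean T n - P = (1 / real n) *\<^sub>R (\<Sum>m = 1..n. blinfun_power T m - P)"
  using assms by (simp add: cesaro_mean_def sum_subtractf scaleR_right_diff_distrib sum_constant_scaleR)

lemma power_bounded_if_powers_converge:
  assumes "blinfun_power T \<longlonglongrightarrow> P"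
  shows "power_bounded T"
proof -
  have "Bseq (blinfun_power T)"
    using assms by (intro convergent_imp_Bseq convergentI)
  then show ?thesis
    unfolding power_bounded_def bdd_above_def Bseq_def by auto
qed

text \<open>
  With a geometric rate the errors \<open>T\<^sup>m - P\<close> have a bounded sum, so the Cesaro means approach \<open>P\<close>
  at the rate \<open>1/n\<close>.
\<close>

lemma uniformly_mean_ergodic_if_geometric:
  assumes q: "0 \<le> q" "q < 1"
    and geom: "\<And>n. norm (blinfun_power T n - P) \<le> K * q ^ n"
  shows "uniformly_mean_ergodic T"
proof -
  have K: "0 \<le> K"
    using order_trans[OF norm_ge_zero geom[of 0]] by simp
  have "norm (cesaro_mean T n - P) \<le> (K / (1 - q)) * (1 / real n)" if "n > 0" for n
  proof -
    have "norm (\<Sum>m = 1..n. blinfun_power T m - P) \<le> (\<Sum>m = 1..n. K * q ^ m)"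
      by (intro sum_norm_le geom)
    also have "\<dots> \<le> (\<Sum>m\<le>n. K * q ^ m)"
      using K q by (intro sum_mono2) auto
    also have "\<dots> = K * ((1 - q ^ Suc n) / (1 - q))"
      using q by (simp add: sum_gp0 flip: sum_distrib_left)
    also have "\<dots> \<le> K * (1 / (1 - q))"
      using K q by (intro mult_left_mono divide_right_mono) auto
    finally show ?thesis
      using that divide_right_mono[of _ _ "real n"] by (fastforce simp: cesaro_mean_diff)
  qed
  then have "\<forall>\<^sub>F n in sequentially. norm (cesaro_mean T n - P) \<le> (K / (1 - q)) * (1 / real n)"
    by (intro eventually_sequentiallyI[of 1]) auto
  moreover have "(\<lambda>n. (K / (1 - q)) * (1 / real n)) \<longlonglongrightarrow> 0"
    by (rule tendsto_mult_right_zero[OF lim_1_over_n])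
  ultimately have "(\<lambda>n. cesaro_mean T n - P) \<longlonglongrightarrow> 0"
    by (rule Lim_null_comparison)
  then have "cesaro_mean T \<longlonglongrightarrow> P"
    by (rule LIM_zero_cancel)
  then show ?thesis
    unfolding uniformly_mean_ergodic_def by (rule convergentI)
qed

lemma blinfun_power_invariant:
  assumes "\<And>x. \<phi> (blinfun_apply T x) = \<phi> x"
  shows "\<phi> (blinfun_apply (blinfun_power T n) x) = \<phi> x"
  by (induction n) (simp_all add: assms)

lemma blinfun_power_fixed:
  assumes "blinfun_apply T x = x"
  shows "blinfun_apply (blinfun_power T n) x = x"
  by (induction n) (simp_all add: assms)

text \<open>
  For a supercyclic vector \<open>x\<close> there are two cases.  If \<open>\<phi> x = 0\<close>, the orbit stays in the closed
  kernel of \<open>\<phi>\<close>, which misses \<open>h\<close>.  Otherwise \<open>\<bar>\<phi>(c T\<^sup>n x)\<bar> = \<bar>c\<bar> \<bar>\<phi> x\<bar>\<close> is proportional to \<open>\<bar>c\<bar>\<close>, and so is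
  the bound \<open>\<bar>c\<bar> M \<parallel>x\<parallel>\<close> that power boundedness gives for \<open>\<parallel>c T\<^sup>n x\<parallel>\<close>; thus the orbit lies in the
  closed set \<open>\<parallel>v\<parallel> \<le> K \<bar>\<phi> v\<bar>\<close>, which misses \<open>y\<close>.
\<close>

lemma not_supercyclic_if_invariant_functional:
  fixes T :: "'a::complex_banach \<Rightarrow>\<^sub>L 'a" and \<phi> :: "'a \<Rightarrow> complex"
  assumes pb: "power_bounded T"
    and cont: "continuous_on UNIV \<phi>"
    and homog: "\<And>c x. \<phi> (c *\<^sub>C x) = c * \<phi> x"
    and invariant: "\<And>x. \<phi> (blinfun_apply T x) = \<phi> x"
    and nontrivial: "\<phi> h \<noteq> 0"
    and kernel: "\<phi> y = 0" "y \<noteq> 0"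
  shows "\<not> supercyclic T"
proof
  assume "supercyclic T"
  then obtain x where
    dense: "closure {c *\<^sub>C blinfun_apply (blinfun_power T n) x | c n. True} = UNIV"
    (is "closure ?orbit = _")
    unfolding supercyclic_def by blast
  have in_closed: "v \<in> S" if "closed S" "?orbit \<subseteq> S" for S v
    using closure_minimal[OF that(2,1)] dense by blast
  have \<phi>_orbit: "\<phi> (c *\<^sub>C blinfun_apply (blinfun_power T n) x) = c * \<phi> x" for c n
    by (simp add: homog blinfun_power_invariant[of \<phi>, OF invariant])
  show False
  proof (cases "\<phi> x = 0")
    case True
    have "h \<in> {v. \<phi> v = 0}"
      by (rule in_closed) (auto intro: closed_Collect_eq cont simp: \<phi>_orbit True)
    then show False
      using nontrivial by simp
  next
    case False
    obtain M where M: "\<And>n. norm (blinfun_power T n) \<le> M"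
      using pb unfolding power_bounded_def bdd_above_def by auto
    let ?K = "M * norm x / cmod (\<phi> x)"
    have "y \<in> {v. norm v \<le> ?K * cmod (\<phi> v)}"
    proof (rule in_closed)
      show "closed {v. norm v \<le> ?K * cmod (\<phi> v)}"
        by (intro closed_Collect_le continuous_intros cont)
      have "norm (c *\<^sub>C blinfun_apply (blinfun_power T n) x) \<le> ?K * cmod (c * \<phi> x)" for c n
      proof -
        have "norm (blinfun_apply (blinfun_power T n) x) \<le> M * norm x"
          using norm_blinfun[of "blinfun_power T n" x] M[of n]
          by (meson mult_right_mono norm_ge_zero order_trans)
        then have "cmod c * norm (blinfun_apply (blinfun_power T n) x) \<le> cmod c * (M * norm x)"
          by (rule mult_left_mono) simp
        also have "\<dots> = ?K * cmod (c * \<phi> x)"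
          using False by (simp add: norm_mult)
        finally show ?thesis
          by (simp add: norm_scaleC)
      qed
      then show "?orbit \<subseteq> {v. norm v \<le> ?K * cmod (\<phi> v)}"
        by (auto simp: \<phi>_orbit)
    qed
    then show False
      using kernel by simp
  qed
qed

text \<open>
  The splitting \<open>x = \<phi>(x) h + (x - \<phi>(x) h)\<close> separates a vector fixed by \<open>T\<close> from one in the kernel
  of \<open>\<phi>\<close>, so the decay on the kernel controls \<open>T\<^sup>n - P\<close> for \<open>P x = \<phi>(x) h\<close>.
\<close>

lemma rank_one_attractor_dynamics:
  fixes T :: "'a::complex_banach \<Rightarrow>\<^sub>L 'a" and \<phi> :: "'a \<Rightarrow> complex"
  assumes T_scaleC: "\<And>c x. blinfun_apply T (c *\<^sub>C x) = c *\<^sub>C blinfun_apply T x"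
    and \<phi>: "bounded_linear \<phi>" "\<And>c x. \<phi> (c *\<^sub>C x) = c * \<phi> x"
    and invariant: "\<And>x. \<phi> (blinfun_apply T x) = \<phi> x"
    and fixed: "blinfun_apply T h = h" "\<phi> h = 1"
    and kernel: "\<phi> y = 0" "y \<noteq> 0"
    and q: "0 \<le> q" "q < 1"
    and decay: "\<And>n x. \<phi> x = 0 \<Longrightarrow> norm (blinfun_apply (blinfun_power T n) x) \<le> A * q ^ n * norm x"
  shows "power_bounded T \<and> uniformly_mean_ergodic T \<and> \<not> supercyclic T"
proof -
  interpret \<phi>: bounded_linear \<phi> by (rule \<phi>(1))
  obtain B where B: "0 \<le> B" "\<And>x. cmod (\<phi> x) \<le> norm x * B"
    using \<phi>.nonneg_bounded by blast
  have "bounded_linear (\<lambda>x. \<phi> x *\<^sub>C h)"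
  proof (rule bounded_linear_intro[where K = "B * norm h"])
    show "\<phi> (r *\<^sub>R x) *\<^sub>C h = r *\<^sub>R \<phi> x *\<^sub>C h" for r x
      by (simp add: \<phi>.scaleR scaleR_conv_of_real scaleC_of_real flip: scaleC_scaleC)
    show "norm (\<phi> x *\<^sub>C h) \<le> norm x * (B * norm h)" for x
      using mult_right_mono[OF B(2) norm_ge_zero] by (simp add: norm_scaleC mult.assoc)
  qed (simp add: \<phi>.add scaleC_add_left)
  then obtain P where P: "\<And>x. blinfun_apply P x = \<phi> x *\<^sub>C h"
    using bounded_linear_Blinfun_apply by metis
  have A: "0 \<le> A"
    using order_trans[OF norm_ge_zero decay[OF kernel(1), of 0]] kernel(2)
    by (simp add: zero_le_mult_iff)
  have geom: "norm (blinfun_power T n - P) \<le> A * (1 + B * norm h) * q ^ n" for n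
  proof (rule norm_blinfun_bound)
    show "0 \<le> A * (1 + B * norm h) * q ^ n"
      using A B q by simp
    fix x
    have "blinfun_apply T (\<phi> x *\<^sub>C h) = \<phi> x *\<^sub>C h"
      by (simp add: T_scaleC fixed)
    then have eq: "blinfun_apply (blinfun_power T n - P) x =
        blinfun_apply (blinfun_power T n) (x - \<phi> x *\<^sub>C h)"
      by (simp add: P blinfun.diff_left blinfun.diff_right blinfun_power_fixed)
    have "norm (blinfun_apply (blinfun_power T n - P) x) \<le> A * q ^ n * norm (x - \<phi> x *\<^sub>C h)"
      unfolding eq by (rule decay) (simp add: \<phi>.diff \<phi>(2) fixed)
    also have "\<dots> \<le> A * q ^ n * (norm x + norm x * B * norm h)"
      using norm_triangle_ineq4[of x "\<phi> x *\<^sub>C h"] mult_right_mono[OF B(2), of "norm h" x] A q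
      by (intro mult_left_mono) (simp_all add: norm_scaleC)
    finally show "norm (blinfun_apply (blinfun_power T n - P) x) \<le>
        A * (1 + B * norm h) * q ^ n * norm x"
      by (simp add: algebra_simps)
  qed
  have "(\<lambda>n. A * (1 + B * norm h) * q ^ n) \<longlonglongrightarrow> 0"
    using q by (intro tendsto_mult_right_zero LIMSEQ_realpow_zero)
  then have "(\<lambda>n. blinfun_power T n - P) \<longlonglongrightarrow> 0"
    by (rule Lim_null_comparison[rotated]) (simp add: geom)
  then have pb: "power_bounded T"
    by (rule power_bounded_if_powers_converge[OF LIM_zero_cancel])
  moreover have "uniformly_mean_ergodic T"
    by (rule uniformly_mean_ergodic_if_geometric[OF q geom])
  moreover have "\<not> supercyclic T"
    by (rule not_supercyclic_if_invariant_functional[OF pb _ \<phi>(2) invariant _ kernel, of h])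
      (use fixed in \<open>auto intro: \<phi>.continuous_on continuous_intros\<close>)
  ultimately show ?thesis by blast
qed

section \<open>Geometric decay on the functions vanishing at the origin\<close>

lemma hinf_Schwarz:
  assumes "hinf_apply g 0 = 0" and z: "z \<in> unit_disc"
  shows "cmod (hinf_apply g z) \<le> norm g * cmod z"
proof (cases "z = 0")
  case False
  \<comment> \<open>The Schwarz lemma needs values strictly inside the unit disc, so \<open>g\<close> is divided by an
    arbitrary \<open>c > \<parallel>g\<parallel>\<close>.\<close>
  have "cmod (hinf_apply g z) / cmod z \<le> norm g"
  proof (rule dense_ge)
    fix c
    assume c: "norm g < c"
    then have c0: "0 < c"
      using norm_ge_zero[of g] by linarith
    have "cmod (hinf_apply g z / c) \<le> cmod z"
    proof (rule Schwarz_Lemma(1)[where f = "\<lambda>z. hinf_apply g z / c"])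
      show "(\<lambda>z. hinf_apply g z / c) holomorphic_on unit_disc"
        using c0 by (intro holomorphic_intros hinf_holomorphic) auto
      show "cmod (hinf_apply g w / c) < 1" for w
        using le_less_trans[OF cmod_le_norm_hinf c] c0 by (simp add: norm_divide)
    qed (use assms in auto)
    then show "cmod (hinf_apply g z) / cmod z \<le> c"
      using c0 False by (simp add: norm_divide divide_le_eq mult.commute)
  qed
  then show ?thesis
    using False by (simp add: divide_le_eq)
qed (use assms in simp)

context
  fixes t :: real
  assumes t: "0 \<le> t" "t < 1"
begin

text \<open>
  The weight \<open>r / (1 - t r)\<^sup>2\<close> is an eigenfunction of \<open>C\<^sub>t\<close>: the derivative of
  \<open>u\<^sup>2 / (2 (1 - t u)\<^sup>2)\<close> is \<open>u / (1 - t u)\<^sup>3\<close>, the weight divided by \<open>1 - t u\<close>.  This primitive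
  therefore majorises, along the radius to \<open>z\<close>, the primitive that defines \<open>C\<^sub>t f(z)\<close>.
\<close>

lemma Cesaro_halves_weight:
  assumes hol: "f holomorphic_on unit_disc"
    and bound: "\<And>z. z \<in> unit_disc \<Longrightarrow> cmod (f z) \<le> M * (cmod z / (1 - t * cmod z)\<^sup>2)"
    and z: "z \<in> unit_disc"
  shows "cmod (Cesaro t f z) \<le> M / 2 * (cmod z / (1 - t * cmod z)\<^sup>2)"
proof (cases "z = 0")
  case True
  then show ?thesis
    using bound[of 0] by (simp add: Cesaro_def)
next
  case False
  obtain F where F:
    "\<And>z. z \<in> unit_disc \<Longrightarrow> (F has_field_derivative f z / (1 - of_real t * z)) (at z)"
    "F 0 = 0" "Cesaro t f z = F z / z"
    using Cesaro_primitive[OF t hol] z False by metis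
  define r where "r = cmod z"
  have r: "0 < r" "r < 1"
    using z False by (auto simp: r_def)
  have pos: "0 < 1 - t * (s * r)" if "0 \<le> s" "s \<le> 1" for s
  proof -
    have "s * r \<le> 1" using that r by (simp add: mult_le_one)
    then have "t * (s * r) \<le> t" using t by (simp add: mult_left_le)
    then show ?thesis using t by simp
  qed
  have in_disc: "of_real s * z \<in> unit_disc" if "0 \<le> s" "s \<le> 1" for s
  proof -
    have "s * r \<le> r"
      using that r by (intro mult_left_le_one_le) auto
    then have "s * r < 1"
      using r by linarith
    then show ?thesis
      using that by (simp add: norm_mult flip: r_def)
  qed
  \<comment> \<open>The radius is parametrised by \<open>s z\<close> with \<open>0 \<le> s \<le> 1\<close>; \<open>Phi\<close> is \<open>M\<close> times the
    primitive \<open>u\<^sup>2 / (2 (1 - t u)\<^sup>2)\<close> at \<open>u = s r\<close>, and the factor \<open>r\<close> in its derivative matches the factor \<open>z\<close> in that of \<open>F(s z)\<close>.\<close>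
  define Phi where "Phi s = M / 2 * (s * r)\<^sup>2 / (1 - t * (s * r))\<^sup>2" for s
  let ?Phi' = "\<lambda>s. M * (s * r) / (1 - t * (s * r)) ^ 3 * r"
  let ?F' = "\<lambda>s. f (of_real s * z) / (1 - of_real t * (of_real s * z)) * z"
  have F': "((\<lambda>s. F (of_real s * z)) has_vector_derivative ?F' s) (at s)"
    if "0 \<le> s" "s \<le> 1" for s :: real
  proof -
    have "((\<lambda>w. F (w * z)) has_field_derivative ?F' s) (at (of_real s))"
      by (rule DERIV_chain2[where f = F and g = "\<lambda>w. w * z" and x = "of_real s", OF F(1)[OF in_disc[OF that]]])
        (auto intro!: derivative_eq_intros)
    then show ?thesis
      by (rule has_vector_derivative_real_field)
  qed
  have Phi': "(Phi has_vector_derivative ?Phi' s) (at s)" if "0 \<le> s" "s \<le> 1" for s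
  proof -
    define u v where "u = s * r" and "v = 1 - t * u"
    have v: "v \<noteq> 0"
      using pos[OF that] by (simp add: u_def v_def)
    have "((\<lambda>s. M / 2 * (s * r)\<^sup>2) has_real_derivative M * u * r) (at s)"
      by (auto intro!: derivative_eq_intros simp: u_def)
    moreover have "((\<lambda>s. (1 - t * (s * r))\<^sup>2) has_real_derivative - (2 * v * t * r)) (at s)"
      by (auto intro!: derivative_eq_intros simp: u_def v_def)
    ultimately have "(Phi has_real_derivative
        (M * u * r * (1 - t * (s * r))\<^sup>2 - M / 2 * (s * r)\<^sup>2 * - (2 * v * t * r)) /
        ((1 - t * (s * r))\<^sup>2 * (1 - t * (s * r))\<^sup>2)) (at s)"
      unfolding Phi_def by (rule DERIV_divide) (use v in \<open>simp add: u_def v_def\<close>)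
    moreover have "M * u * r * v\<^sup>2 - M / 2 * u\<^sup>2 * - (2 * v * t * r) = M * u * r * v * (v + t * u)"
      by (simp add: power2_eq_square algebra_simps)
    moreover have "v + t * u = 1"
      by (simp add: v_def)
    ultimately have "(Phi has_real_derivative M * u * r * v / (v\<^sup>2 * v\<^sup>2)) (at s)"
      by (simp only: u_def[symmetric] v_def[symmetric] mult_1_right)
    moreover have "M * u * r * v / (v\<^sup>2 * v\<^sup>2) = M * u / v ^ 3 * r"
      using v by (simp add: power2_eq_square power3_eq_cube)
    ultimately show ?thesis
      unfolding has_real_derivative_iff_has_vector_derivative[symmetric]
      by (simp only: u_def v_def)
  qed
  have "norm (F (of_real 1 * z) - F (of_real 0 * z)) \<le> Phi 1 - Phi 0"
  proof (rule differentiable_bound_general[where f' = ?F' and \<phi>' = ?Phi'])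
    show "continuous_on {0..1} (\<lambda>s. F (of_real s * z))"
      by (rule continuous_at_imp_continuous_on)
        (use F' in \<open>force intro: has_vector_derivative_continuous\<close>)
    show "continuous_on {0..1} Phi"
      by (rule continuous_at_imp_continuous_on)
        (use Phi' in \<open>force intro: has_vector_derivative_continuous\<close>)
    fix s :: real
    assume "0 < s" "s < 1"
    then have s: "0 \<le> s" "s \<le> 1" by auto
    have nz: "cmod (of_real s * z) = s * r"
      using s by (simp add: norm_mult r_def)
    have low: "1 - t * (s * r) \<le> cmod (1 - of_real t * (of_real s * z))"
      using norm_triangle_ineq2[of 1 "of_real t * (of_real s * z)"] t s
      by (simp add: norm_mult r_def)
    have "cmod (f (of_real s * z)) \<le> M * (s * r) / (1 - t * (s * r))\<^sup>2"
      using bound[OF in_disc[OF s]] by (simp only: nz times_divide_eq_right)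
    then have "norm (?F' s) \<le> M * (s * r) / (1 - t * (s * r))\<^sup>2 / (1 - t * (s * r)) * r"
      unfolding norm_mult norm_divide r_def[symmetric]
      using low pos[OF s] r
      by (intro mult_right_mono frac_le) (auto intro: order_trans[OF norm_ge_zero])
    then show "norm (?F' s) \<le> ?Phi' s"
      by (simp add: power2_eq_square power3_eq_cube mult_ac)
  qed (use F' Phi' in auto)
  then have "cmod (F z) \<le> M / 2 * r\<^sup>2 / (1 - t * r)\<^sup>2"
    by (simp add: F(2) Phi_def)
  then show ?thesis
    using r by (simp add: F(3) norm_divide divide_le_eq power2_eq_square mult_ac flip: r_def)
qed

lemma Cesaro_hinf_power_decay:
  assumes g: "hinf_apply g 0 = 0"
  shows "norm (blinfun_apply (blinfun_power (Cesaro_hinf t) n) g) \<le>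
    1 / (1 - t)\<^sup>2 * (1 / 2) ^ n * norm g"
proof -
  let ?T = "blinfun_power (Cesaro_hinf t)"
  \<comment> \<open>The bound by the weight is what iterates; the norm estimate is read off only at the end.\<close>
  have bound: "cmod (hinf_apply (blinfun_apply (?T n) g) z) \<le>
      norm g * (1 / 2) ^ n * (cmod z / (1 - t * cmod z)\<^sup>2)" if "z \<in> unit_disc" for z
    using that
  proof (induction n arbitrary: z)
    case 0
    have "t * cmod z \<le> t"
      using 0 t by (simp add: mult_left_le)
    then have "t * cmod z < 1"
      using t by simp
    then have "(1 - t * cmod z)\<^sup>2 \<le> 1" "0 < (1 - t * cmod z)\<^sup>2"
      using t by (auto simp: abs_square_le_1)
    then have "cmod z \<le> cmod z / (1 - t * cmod z)\<^sup>2"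
      by (simp add: le_divide_eq mult_left_le)
    then have "norm g * cmod z \<le> norm g * (cmod z / (1 - t * cmod z)\<^sup>2)"
      by (rule mult_left_mono) simp
    then show ?case
      using hinf_Schwarz[OF g 0] by simp
  next
    case (Suc n)
    have "cmod (Cesaro t (hinf_apply (blinfun_apply (?T n) g)) z) \<le>
        norm g * (1 / 2) ^ n / 2 * (cmod z / (1 - t * cmod z)\<^sup>2)"
      by (rule Cesaro_halves_weight[OF hinf_holomorphic Suc.IH Suc.prems])
    then show ?case
      by (simp add: Cesaro_hinf_apply[OF t])
  qed
  show ?thesis
  proof (rule norm_hinf_le)
    fix z :: complex
    assume z: "z \<in> unit_disc"
    then have "t * cmod z \<le> t"
      using t by (simp add: mult_left_le)
    then have "(1 - t)\<^sup>2 \<le> (1 - t * cmod z)\<^sup>2"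
      using t by (intro power_mono) auto
    then have "cmod z / (1 - t * cmod z)\<^sup>2 \<le> 1 / (1 - t)\<^sup>2"
      using z t by (intro frac_le) auto
    then have "norm g * (1 / 2) ^ n * (cmod z / (1 - t * cmod z)\<^sup>2) \<le>
        norm g * (1 / 2) ^ n * (1 / (1 - t)\<^sup>2)"
      by (rule mult_left_mono) simp
    then show "cmod (hinf_apply (blinfun_apply (?T n) g) z) \<le>
        1 / (1 - t)\<^sup>2 * (1 / 2) ^ n * norm g"
      using order_trans[OF bound[OF z]] by (simp add: mult_ac)
  qed
qed

section \<open>The fixed function and the disc algebra\<close>

text \<open>
  For \<open>f(z) = 1 / (1 - t z)\<close> the integrand is \<open>1 / (1 - t z)\<^sup>2\<close>, with primitive \<open>z / (1 - t z) = z f(z)\<close>.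
\<close>

lemma Cesaro_fixed:
  assumes f: "\<And>z. z \<in> unit_disc \<Longrightarrow> f z = 1 / (1 - of_real t * z)"
    and z: "z \<in> unit_disc"
  shows "Cesaro t f z = f z"
proof (cases "z = 0")
  case False
  have sub: "closed_segment 0 z \<subseteq> unit_disc"
    using z by (intro closed_segment_subset) auto
  have "((\<lambda>z. z / (1 - of_real t * z)) has_field_derivative f w / (1 - of_real t * w))
      (at w within unit_disc)" if "w \<in> unit_disc" for w
    using denom_nonzero[OF t that]
    by (auto intro!: derivative_eq_intros simp: f[OF that] field_simps power2_eq_square)
  then have "((\<lambda>w. f w / (1 - of_real t * w)) has_contour_integral
      z / (1 - of_real t * z) - 0 / (1 - of_real t * 0)) (linepath 0 z)"
    using contour_integral_primitive[where g = "linepath 0 z" and S = unit_disc] sub by fastforce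
  then show ?thesis
    using z False by (simp add: Cesaro_def contour_integral_unique f[OF z])
qed (use z in \<open>simp add: Cesaro_def\<close>)

end

lemma disc_algebra_exists:
  assumes "continuous_on (closure unit_disc) f" "f holomorphic_on unit_disc"
  obtains g :: disc_algebra where "\<And>z. z \<in> unit_disc \<Longrightarrow> hinf_apply (disc_to_hinf g) z = f z"
proof -
  let ?g = "\<lambda>z. if z \<in> unit_disc then f z else 0"
  have "bounded (f ` closure unit_disc)"
    by (intro compact_imp_bounded compact_continuous_image assms) auto
  then have "bounded (f ` unit_disc)"
    by (rule bounded_subset) (use closure_subset in blast)
  moreover have "f ` unit_disc = ?g ` unit_disc"
    by (rule image_cong) auto
  ultimately have "bounded (?g ` unit_disc)"
    by (simp only:)
  moreover have "?g holomorphic_on unit_disc"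
    using assms(2) by (rule holomorphic_transform) auto
  ultimately have app: "hinf_apply (Abs_hinf ?g) = ?g"
    by (intro Abs_hinf_inverse) auto
  then have "extends_continuously (Abs_hinf ?g)"
    unfolding extends_continuously_def using assms(1) by auto
  then show thesis
    using app by (intro that[of "Abs_disc_algebra (Abs_hinf ?g)"]) (simp add: Abs_disc_algebra_inverse)
qed

lemma disc_to_hinf_Cesaro_disc_power:
  assumes "0 \<le> t" "t < 1"
  shows "disc_to_hinf (blinfun_apply (blinfun_power (Cesaro_disc t) n) f) =
    blinfun_apply (blinfun_power (Cesaro_hinf t) n) (disc_to_hinf f)"
  by (induction n) (simp_all add: disc_to_hinf_Cesaro_disc[OF assms])

lemma bounded_linear_hinf_apply: "bounded_linear (\<lambda>f. hinf_apply f z)"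
  by (rule bounded_linear_intro[where K = 1])
    (simp_all add: hinf_apply_add hinf_apply_scaleR cmod_le_norm_hinf scaleR_conv_of_real)

lemma bounded_linear_disc_to_hinf: "bounded_linear disc_to_hinf"
  by (rule bounded_linear_intro[where K = 1])
    (simp_all add: plus_disc_algebra.rep_eq scaleR_disc_algebra.rep_eq norm_disc_to_hinf)

theorem proposition2p4:
  fixes t :: real
  assumes "0 \<le> t" and "t < 1"
  shows "power_bounded (Cesaro_hinf t) \<and> uniformly_mean_ergodic (Cesaro_hinf t) \<and>
           \<not> supercyclic (Cesaro_hinf t) \<and>
         power_bounded (Cesaro_disc t) \<and> uniformly_mean_ergodic (Cesaro_disc t) \<and>
           \<not> supercyclic (Cesaro_disc t)"
proof -
  have denom: "1 - of_real t * z \<noteq> 0" if "z \<in> closure unit_disc" for z :: complex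
  proof
    assume "1 - of_real t * z = 0"
    then have "cmod (of_real t * z) = 1"
      by (metis eq_iff_diff_eq_0 norm_one)
    moreover have "cmod (of_real t * z) \<le> t"
      using that assms by (simp add: norm_mult mult_left_le)
    ultimately show False
      using assms by simp
  qed
  have "continuous_on (closure unit_disc) (\<lambda>z. 1 / (1 - of_real t * z))"
    using denom by (intro continuous_intros) blast+
  moreover have "(\<lambda>z. 1 / (1 - of_real t * z)) holomorphic_on unit_disc"
    using denom_nonzero[OF assms] by (intro holomorphic_intros) blast+
  ultimately obtain h where
    h: "\<And>z. z \<in> unit_disc \<Longrightarrow> hinf_apply (disc_to_hinf h) z = 1 / (1 - of_real t * z)"
    using disc_algebra_exists by blast
  \<comment> \<open>The identity function is a nonzero element of the kernel of evaluation at the origin.\<close>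
  obtain y where y: "\<And>z. z \<in> unit_disc \<Longrightarrow> hinf_apply (disc_to_hinf y) z = z"
    by (rule disc_algebra_exists[of "\<lambda>z. z"]) (auto intro: continuous_intros holomorphic_intros)
  have h0: "hinf_apply (disc_to_hinf h) 0 = 1" and y0: "hinf_apply (disc_to_hinf y) 0 = 0"
    by (simp_all add: h y)
  have y_nonzero: "disc_to_hinf y \<noteq> 0"
    using y[of "1 / 2"] by (auto simp: hinf_apply_zero)
  have fixed: "blinfun_apply (Cesaro_hinf t) (disc_to_hinf h) = disc_to_hinf h"
    by (rule hinf_eqI) (simp only: Cesaro_hinf_apply[OF assms] Cesaro_fixed[OF assms h])
  have invariant: "hinf_apply (blinfun_apply (Cesaro_hinf t) f) 0 = hinf_apply f 0" for f
    by (simp add: Cesaro_hinf_apply[OF assms] Cesaro_def)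
  have "power_bounded (Cesaro_hinf t) \<and> uniformly_mean_ergodic (Cesaro_hinf t) \<and>
      \<not> supercyclic (Cesaro_hinf t)"
    by (rule rank_one_attractor_dynamics[where \<phi> = "\<lambda>f. hinf_apply f 0" and h = "disc_to_hinf h"
          and y = "disc_to_hinf y" and q = "1 / 2" and A = "1 / (1 - t)\<^sup>2"])
      (simp_all only: Cesaro_hinf_scaleC[OF assms] bounded_linear_hinf_apply hinf_apply_scaleC
        invariant fixed h0 y0 y_nonzero Cesaro_hinf_power_decay[OF assms], simp_all)
  moreover have "power_bounded (Cesaro_disc t) \<and> uniformly_mean_ergodic (Cesaro_disc t) \<and>
      \<not> supercyclic (Cesaro_disc t)"
  proof (rule rank_one_attractor_dynamics[where \<phi> = "\<lambda>f. hinf_apply (disc_to_hinf f) 0" and h = h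
        and y = y and q = "1 / 2" and A = "1 / (1 - t)\<^sup>2"])
    show "bounded_linear (\<lambda>f. hinf_apply (disc_to_hinf f) 0)"
      by (rule bounded_linear_compose[OF bounded_linear_hinf_apply bounded_linear_disc_to_hinf])
    show "blinfun_apply (Cesaro_disc t) h = h"
      using fixed by (simp add: disc_to_hinf_Cesaro_disc[OF assms] flip: disc_to_hinf_inject)
    show "y \<noteq> 0"
      using y_nonzero by (metis zero_disc_algebra.rep_eq)
    show "norm (blinfun_apply (blinfun_power (Cesaro_disc t) n) f) \<le>
        1 / (1 - t)\<^sup>2 * (1 / 2) ^ n * norm f" if "hinf_apply (disc_to_hinf f) 0 = 0" for n f
      using Cesaro_hinf_power_decay[OF assms that, of n]
      by (simp add: norm_disc_to_hinf flip: disc_to_hinf_Cesaro_disc_power[OF assms])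
  qed (simp_all add: Cesaro_disc_scaleC[OF assms] scaleC_disc_algebra.rep_eq hinf_apply_scaleC
      disc_to_hinf_Cesaro_disc[OF assms] invariant h0 y0)
  ultimately show ?thesis by blast
qed

end
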